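(* Consider the problem $\min_{\mathbf{x}\in\mathcal{X}}\max_{|S|\le k}f(\mathbf{x},S)$, where $\mathcal{X}\subset\mathbb{R}^d$ is convex and bounded, and $f:\mathbb{R}^d\times2^V\to\mathbb{R}_+$ is convex in $\mathbf{x}$ and monotone submodular in $S$. Suppose that there is $L$ such that $\|\nabla_{\mathbf{x}}f(\mathbf{x},S)-\nabla_{\mathbf{x}}f(\mathbf{x}',S)\|\le L\|\mathbf{x}-\mathbf{x}'\|$ for all $\mathbf{x},\mathbf{x}'\in\mathbb{R}^d$ and all $S$ with $|S|\le k$. Then the output $\mathbf{x}_{sol}$ of the Extra-Gradient Greedy (EGG) algorithm after $\mathcal{O}(1/\epsilon^2)$ iterations with step size $\mathcal{O}(\epsilon)$ is a $((1-1/e),\epsilon)$-approximate minimax solution, i.e. $$(1-1/e)\max_{|S|\le k}f(\mathbf{x}_{sol},S)\le \min_{\mathbf{x}\in\mathcal{X}}\max_{|S|\le k}f(\mathbf{x},S)+\epsilon .$$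
   Context: $V$ is a finite ground set with $n$ elements and $k\le n$ is a positive integer. A set function $g:2^V\to\mathbb{R}$ is submodular if $g(A\cap B)+g(A\cup B)\le g(A)+g(B)$ for all $A,B\subseteq V$, and monotone if $g(A)\le g(B)$ whenever $A\subseteq B$. $\pi_{\mathcal{X}}$ denotes Euclidean projection onto $\mathcal{X}$ (assumed well defined), and $\nabla f(\mathbf{x},S)=\nabla_{\mathbf{x}}f(\mathbf{x},S)$. Greedy subroutine $\textsc{Greedy}(f,k,\mathbf{x})$: with $\Delta_ef(\mathbf{x},S)=f(\mathbf{x},S\cup\{e\})-f(\mathbf{x},S)$, start from the empty set $S_0=\emptyset$ and for $i=0,\dots,k-1$ set $S_{i+1}=S_i\cup\{\arg\max_{e\in V}\Delta_ef(\mathbf{x},S_i)\}$; return $S_k$. Extra-Gradient Greedy (EGG): initialize $S_1=\emptyset$, $\mathbf{x}_1=\mathbf{0}$. For $t=1,\dots,T$: $\hat{\mathbf{x}}_t=\pi_{\mathcal{X}}(\mathbf{x}_t-\gamma_t\nabla f(\mathbf{x}_t,S_t))$, $\hat S_t=\textsc{Greedy}(f,k,\hat{\mathbf{x}}_t)$, $\mathbf{x}_{t+1}=\pi_{\mathcal{X}}(\mathbf{x}_t-\gamma_t\nabla f(\hat{\mathbf{x}}_t,\hat S_t))$, $S_{t+1}=\textsc{Greedy}(f,k,\mathbf{x}_{t+1})$, where $\gamma_t>0$ are step sizes. Output $\mathbf{x}_{sol}=\big(\sum_{t=1}^T\gamma_t\big)^{-1}\sum_{t=1}^T\gamma_t\hat{\mathbf{x}}_t$.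 Meaning of the asymptotic statement: there are constants, independent of $\epsilon$ (they may depend on $f,\mathcal{X},k$ and the constants in the hypotheses), such that for all sufficiently small $\epsilon>0$ the conclusion holds for a suitable number of iterations $T$ that is at most a constant times $1/\epsilon^2$ and suitable step sizes at most a constant times $\epsilon$. *)

theory Defs
  imports "HOL-Analysis.Analysis"
begin

definition submodular_on :: "'v set \<Rightarrow> ('v set \<Rightarrow> real) \<Rightarrow> bool" where
  "submodular_on V g \<longleftrightarrow>
     (\<forall>A B. A \<subseteq> V \<longrightarrow> B \<subseteq> V \<longrightarrow> g (A \<inter> B) + g (A \<union> B) \<le> g A + g B)"

(* Meaningful only at points where g is differentiable. *)
definition gradient :: "('a::euclidean_space \<Rightarrow> real) \<Rightarrow> 'a \<Rightarrow> 'a" where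
  "gradient g x = (THE D. GDERIV g x :> D)"

definition marginal :: "('a \<Rightarrow> 'v set \<Rightarrow> real) \<Rightarrow> 'a \<Rightarrow> 'v set \<Rightarrow> 'v \<Rightarrow> real" where
  "marginal f x S e = f x (S \<union> {e}) - f x S"

(* The arg max need not be unique, so the subroutine is rendered as a relation:
   S is a possible output for some way of breaking ties. As in the algorithm,
   the arg max ranges over all of V, so an element already chosen may be chosen again. *)
definition greedy_output ::
    "'v set \<Rightarrow> ('a \<Rightarrow> 'v set \<Rightarrow> real) \<Rightarrow> nat \<Rightarrow> 'a \<Rightarrow> 'v set \<Rightarrow> bool" where
  "greedy_output V f k x S \<longleftrightarrow>
     (\<exists>G. G 0 = {} \<and> G k = S \<and>
        (\<forall>i<k. \<exists>e. is_arg_max (marginal f x (G i)) (\<lambda>e. e \<in> V) e \<and>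
                  G (Suc i) = G i \<union> {e}))"

(* (x, xh, S, Sh) are the iterates of the first T iterations for some tie-breaking
   in the calls of the greedy subroutine; xh and Sh are the extrapolated ("hat") iterates.
   All sequences are indexed from 1; the values at 0 are irrelevant. *)
definition egg_run ::
    "'v set \<Rightarrow> ('a::euclidean_space \<Rightarrow> 'v set \<Rightarrow> real) \<Rightarrow> nat \<Rightarrow> 'a set \<Rightarrow> (nat \<Rightarrow> real) \<Rightarrow> nat \<Rightarrow>
     (nat \<Rightarrow> 'a) \<Rightarrow> (nat \<Rightarrow> 'a) \<Rightarrow> (nat \<Rightarrow> 'v set) \<Rightarrow> (nat \<Rightarrow> 'v set) \<Rightarrow> bool" where
  "egg_run V f k X \<gamma> T x xh S Sh \<longleftrightarrow>
     x 1 = 0 \<and> S 1 = {} \<and>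
     (\<forall>t\<in>{1..T}.
        xh t = closest_point X (x t - \<gamma> t *\<^sub>R gradient (\<lambda>y. f y (S t)) (x t)) \<and>
        greedy_output V f k (xh t) (Sh t) \<and>
        x (t + 1) = closest_point X (x t - \<gamma> t *\<^sub>R gradient (\<lambda>y. f y (Sh t)) (xh t)) \<and>
        greedy_output V f k (x (t + 1)) (S (t + 1)))"

definition egg_solution ::
    "(nat \<Rightarrow> real) \<Rightarrow> nat \<Rightarrow> (nat \<Rightarrow> 'a::real_vector) \<Rightarrow> 'a" where
  "egg_solution \<gamma> T xh = inverse (\<Sum>t=1..T. \<gamma> t) *\<^sub>R (\<Sum>t=1..T. \<gamma> t *\<^sub>R xh t)"

definition max_value :: "'v set \<Rightarrow> ('a \<Rightarrow> 'v set \<Rightarrow> real) \<Rightarrow> nat \<Rightarrow> 'a \<Rightarrow> real" where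
  "max_value V f k x = Max ((\<lambda>S. f x S) ` {S. S \<subseteq> V \<and> card S \<le> k})"

(* For nonempty compact X and f continuous in x the infimum is attained, i.e. it is a minimum. *)
definition minimax_value :: "'v set \<Rightarrow> ('a \<Rightarrow> 'v set \<Rightarrow> real) \<Rightarrow> nat \<Rightarrow> 'a set \<Rightarrow> real" where
  "minimax_value V f k X = (INF x\<in>X. max_value V f k x)"

definition approx_minimax_solution ::
    "'v set \<Rightarrow> ('a \<Rightarrow> 'v set \<Rightarrow> real) \<Rightarrow> nat \<Rightarrow> 'a set \<Rightarrow> real \<Rightarrow> real \<Rightarrow> 'a \<Rightarrow> bool" where
  "approx_minimax_solution V f k X \<alpha> \<epsilon> x \<longleftrightarrow>
     \<alpha> * max_value V f k x \<le> minimax_value V f k X + \<epsilon>"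

end

theory Submission
  imports Defs
begin

text \<open>
  Bounded gradients are enough for the stated rate. Every gradient that occurs is taken at a point
  of norm at most \<open>B\<close>, where \<open>B\<close> bounds \<open>X\<close>, and belongs to one of finitely many sets, so the
  Lipschitz condition bounds all of them by a single constant \<open>G\<close>. Since the projection onto \<open>X\<close>
  is nonexpansive, the extrapolated point differs from the current iterate by at most \<open>\<gamma> G\<close>,
  except in the first iteration, where the starting point \<open>0\<close> may lie outside \<open>X\<close> and the
  distance of \<open>0\<close> to \<open>X\<close> has to be added. Hence taking the gradient at the extrapolated point
  changes the usual regret bound of projected gradient descent by terms that do no harm: with a
  constant step size \<open>\<gamma>\<close> and any \<open>u \<in> X\<close>, the inner product of that gradient with the
  difference of the extrapolated point and \<open>u\<close> is, on average over \<open>T\<close> rounds, at most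
  \<open>B\<^sup>2 / (2 \<gamma> T) + G B / T + 3 \<gamma> G\<^sup>2 / 2\<close> (\<open>extrapolated_gradient_regret\<close>).
  With \<open>\<gamma>\<close> proportional to \<open>\<epsilon>\<close> and \<open>T\<close> proportional to \<open>1 / \<epsilon>\<^sup>2\<close> this is at most \<open>\<epsilon>\<close>.
  By convexity the same bound holds for the average difference of the values at the extrapolated
  point and at \<open>u\<close>, both for the set chosen in that round.

  The set of a round is a greedy solution at the extrapolated point, so its value there is at
  least \<open>1 - 1/e\<close> times the maximum over all admissible sets (\<open>greedy_approximation\<close>), whereas at
  \<open>u\<close> its value is at most the maximum at \<open>u\<close>. Convexity of the maximum in the point
  (\<open>convex_on_max_value\<close>) passes from the average of the values to the value at the averaged
  point, and the infimum over \<open>u\<close> gives the claim.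
\<close>

section \<open>The greedy algorithm for monotone submodular functions\<close>

lemma submodular_on_union_le:
  assumes sub: "submodular_on V g" and "A \<subseteq> V" and "finite B" and "B \<subseteq> V"
  shows "g (A \<union> B) \<le> g A + (\<Sum>e\<in>B. g (A \<union> {e}) - g A)"
  using \<open>finite B\<close> \<open>B \<subseteq> V\<close>
proof (induction B)
  case empty
  then show ?case by simp
next
  case (insert e B)
  show ?case
  proof (cases "e \<in> A")
    case True
    then have "A \<union> insert e B = A \<union> B" "A \<union> {e} = A" by auto
    then show ?thesis using insert by simp
  next
    case False
    then have "(A \<union> B) \<inter> (A \<union> {e}) = A" "(A \<union> B) \<union> (A \<union> {e}) = A \<union> insert e B"
      using insert.hyps by auto
    moreover have "g ((A \<union> B) \<inter> (A \<union> {e})) + g ((A \<union> B) \<union> (A \<union> {e})) \<le> g (A \<union> B) + g (A \<union> {e})"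
      using sub[unfolded submodular_on_def, rule_format, of "A \<union> B" "A \<union> {e}"] \<open>A \<subseteq> V\<close> insert.prems
      by simp
    ultimately show ?thesis using insert by simp
  qed
qed

text \<open>
  The marginal gains over \<open>A\<close> of the at most \<open>k\<close> elements of \<open>Q\<close> sum to at least \<open>g Q - g A\<close>, so
  the best single element closes at least a fraction \<open>1/k\<close> of that gap. If \<open>e\<close> already lies in \<open>A\<close>, then no
  element improves on \<open>A\<close>, and the bound holds because the gap is not positive.
\<close>
lemma greedy_step_gap:
  assumes "finite V" and "k \<ge> 1" and sub: "submodular_on V g" and mono: "mono_on (Pow V) g"
    and "A \<subseteq> V" and "Q \<subseteq> V" and "card Q \<le> k" and "e \<in> V"
    and best: "\<And>y. y \<in> V \<Longrightarrow> g (A \<union> {y}) \<le> g (A \<union> {e})"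
  shows "g Q - g (A \<union> {e}) \<le> (1 - 1 / real k) * (g Q - g A)"
proof -
  define m where "m = g (A \<union> {e}) - g A"
  have "finite Q" using \<open>Q \<subseteq> V\<close> \<open>finite V\<close> by (rule finite_subset)
  have "m \<ge> 0"
    unfolding m_def using mono_onD[OF mono, of A "A \<union> {e}"] \<open>A \<subseteq> V\<close> \<open>e \<in> V\<close> by auto
  have "g Q \<le> g (A \<union> Q)"
    using mono_onD[OF mono, of Q "A \<union> Q"] \<open>A \<subseteq> V\<close> \<open>Q \<subseteq> V\<close> by auto
  also have "\<dots> \<le> g A + (\<Sum>y\<in>Q. g (A \<union> {y}) - g A)"
    using sub \<open>A \<subseteq> V\<close> \<open>finite Q\<close> \<open>Q \<subseteq> V\<close> by (rule submodular_on_union_le)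
  also have "(\<Sum>y\<in>Q. g (A \<union> {y}) - g A) \<le> (\<Sum>y\<in>Q. m)"
    unfolding m_def using best \<open>Q \<subseteq> V\<close> by (intro sum_mono) auto
  also have "\<dots> \<le> real k * m"
    using \<open>card Q \<le> k\<close> \<open>m \<ge> 0\<close> by (simp add: mult_right_mono)
  finally have "(g Q - g A) / real k \<le> m"
    using \<open>k \<ge> 1\<close> by (simp add: field_simps)
  then show ?thesis by (simp add: m_def algebra_simps diff_divide_distrib)
qed

lemma one_minus_inverse_power_le:
  assumes "k \<ge> 1"
  shows "(1 - 1 / real k) ^ k \<le> 1 / exp 1"
proof -
  have "1 - 1 / real k \<le> exp (- (1 / real k))"
    using exp_ge_add_one_self[of "- (1 / real k)"] by simp
  then have "(1 - 1 / real k) ^ k \<le> exp (- (1 / real k)) ^ k"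
    using assms by (intro power_mono) auto
  also have "\<dots> = exp (real k * - (1 / real k))" by (rule exp_of_nat_mult [symmetric])
  also have "\<dots> = 1 / exp 1" using assms by (simp add: exp_minus inverse_eq_divide)
  finally show ?thesis .
qed

lemma greedy_output_feasible:
  assumes "finite V" and "greedy_output V f k x S"
  shows "S \<subseteq> V" and "card S \<le> k"
proof -
  obtain A where A: "A 0 = {}" "A k = S"
    and step: "\<And>i. i < k \<Longrightarrow> \<exists>e\<in>V. A (Suc i) = A i \<union> {e}"
    using assms(2) unfolding greedy_output_def is_arg_max_linorder by metis
  have "A i \<subseteq> V \<and> card (A i) \<le> i" if "i \<le> k" for i
    using that
  proof (induction i)
    case 0
    then show ?case using A by simp
  next
    case (Suc i)
    then obtain e where "e \<in> V" "A (Suc i) = A i \<union> {e}" using step[of i] by auto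
    then show ?case
      using Suc card_insert_le_m1[of "Suc i" "A i" e] by auto
  qed
  from this[of k] show "S \<subseteq> V" "card S \<le> k" using A by auto
qed

lemma greedy_approximation:
  assumes "finite V" and "k \<ge> 1" and sub: "submodular_on V (f x)" and mono: "mono_on (Pow V) (f x)"
    and "0 \<le> f x {}" and greedy: "greedy_output V f k x S" and "Q \<subseteq> V" and "card Q \<le> k"
  shows "(1 - 1 / exp 1) * f x Q \<le> f x S"
proof -
  obtain A where A: "A 0 = {}" "A k = S"
    and step: "\<And>i. i < k \<Longrightarrow> \<exists>e. is_arg_max (marginal f x (A i)) (\<lambda>e. e \<in> V) e \<and> A (Suc i) = A i \<union> {e}"
    using greedy unfolding greedy_output_def by metis
  have "A i \<subseteq> V \<and> f x Q - f x (A i) \<le> (1 - 1 / real k) ^ i * (f x Q - f x {})" if "i \<le> k" for i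
    using that
  proof (induction i)
    case 0
    then show ?case using A by simp
  next
    case (Suc i)
    then obtain e where e: "e \<in> V" "A (Suc i) = A i \<union> {e}"
      and best: "\<And>y. y \<in> V \<Longrightarrow> f x (A i \<union> {y}) \<le> f x (A i \<union> {e})"
      using step[of i] unfolding is_arg_max_linorder marginal_def by fastforce
    have "A i \<subseteq> V" using Suc by simp
    have "f x Q - f x (A (Suc i)) \<le> (1 - 1 / real k) * (f x Q - f x (A i))"
      unfolding e using greedy_step_gap[OF \<open>finite V\<close> \<open>k \<ge> 1\<close> sub mono \<open>A i \<subseteq> V\<close> \<open>Q \<subseteq> V\<close> \<open>card Q \<le> k\<close> e(1) best] .
    also have "\<dots> \<le> (1 - 1 / real k) * ((1 - 1 / real k) ^ i * (f x Q - f x {}))"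
      using Suc \<open>k \<ge> 1\<close> by (intro mult_left_mono) auto
    finally show ?case using \<open>A i \<subseteq> V\<close> e by (simp add: mult.assoc)
  qed
  from this[of k] have "f x Q - f x S \<le> (1 - 1 / real k) ^ k * (f x Q - f x {})"
    using A by simp
  also have "\<dots> \<le> 1 / exp 1 * (f x Q - f x {})"
    using one_minus_inverse_power_le[OF \<open>k \<ge> 1\<close>] mono_onD[OF mono, of "{}" Q] \<open>Q \<subseteq> V\<close>
    by (intro mult_right_mono) auto
  also have "\<dots> \<le> 1 / exp 1 * f x Q"
    using \<open>0 \<le> f x {}\<close> by (intro mult_left_mono) auto
  finally show ?thesis by (simp add: algebra_simps)
qed

section \<open>The maximum over the admissible sets\<close>

lemma
  assumes "finite V"
  shows max_value_upper: "\<And>S. S \<subseteq> V \<Longrightarrow> card S \<le> k \<Longrightarrow> f x S \<le> max_value V f k x"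
    and max_value_attained: "\<exists>S. S \<subseteq> V \<and> card S \<le> k \<and> max_value V f k x = f x S"
proof -
  let ?F = "{S. S \<subseteq> V \<and> card S \<le> k}"
  have fin: "finite (f x ` ?F)" using assms by simp
  show "f x S \<le> max_value V f k x" if "S \<subseteq> V" "card S \<le> k" for S
    unfolding max_value_def using fin that by (intro Max_ge) auto
  have "{} \<in> ?F" by simp
  then have "Max (f x ` ?F) \<in> f x ` ?F" using fin by (intro Max_in) blast+
  then show "\<exists>S. S \<subseteq> V \<and> card S \<le> k \<and> max_value V f k x = f x S"
    unfolding max_value_def by blast
qed

lemma convex_on_max_value:
  assumes "finite V" and cvx: "\<And>S. S \<subseteq> V \<Longrightarrow> convex_on UNIV (\<lambda>x. f x S)"
  shows "convex_on UNIV (max_value V f k)"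
proof (rule convex_onI)
  fix t :: real and x y
  assume t: "0 < t" "t < 1"
  obtain S where S: "S \<subseteq> V" "card S \<le> k"
    and eq: "max_value V f k ((1 - t) *\<^sub>R x + t *\<^sub>R y) = f ((1 - t) *\<^sub>R x + t *\<^sub>R y) S"
    using max_value_attained[OF \<open>finite V\<close>] by metis
  have "f ((1 - t) *\<^sub>R x + t *\<^sub>R y) S \<le> (1 - t) * f x S + t * f y S"
    using convex_onD[OF cvx[OF S(1)], of t x y] t by simp
  also have "\<dots> \<le> (1 - t) * max_value V f k x + t * max_value V f k y"
    using max_value_upper[OF \<open>finite V\<close> S] t by (intro add_mono mult_left_mono) auto
  finally show "max_value V f k ((1 - t) *\<^sub>R x + t *\<^sub>R y)
      \<le> (1 - t) * max_value V f k x + t * max_value V f k y"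
    using eq by simp
qed simp

section \<open>Gradients of convex functions\<close>

lemma GDERIV_gradient:
  fixes g :: "'a::euclidean_space \<Rightarrow> real"
  assumes "g differentiable (at x)"
  shows "GDERIV g x :> gradient g x"
proof -
  obtain g' where g': "(g has_derivative g') (at x)"
    using assms unfolding differentiable_def by blast
  define D where "D = (\<Sum>b\<in>Basis. g' b *\<^sub>R b)"
  interpret linear g' using g' by (rule has_derivative_linear)
  have "g' h = h \<bullet> D" for h
  proof -
    have "g' h = g' (\<Sum>b\<in>Basis. (h \<bullet> b) *\<^sub>R b)" by (simp add: euclidean_representation)
    also have "\<dots> = h \<bullet> D" by (simp add: sum scale D_def inner_sum_right mult.commute)
    finally show ?thesis .
  qed
  then have "GDERIV g x :> D" using g' unfolding gderiv_def by presburger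
  moreover have "D' = D" if "GDERIV g x :> D'" for D'
  proof -
    have "(\<lambda>h. h \<bullet> D') = (\<lambda>h. h \<bullet> D)"
      using that \<open>GDERIV g x :> D\<close> has_derivative_unique unfolding gderiv_def by blast
    then show ?thesis by (metis inner_commute vector_eq_rdot)
  qed
  ultimately show ?thesis unfolding gradient_def by (metis theI)
qed

lemma convex_on_gradient_lower_bound:
  fixes g :: "'a::euclidean_space \<Rightarrow> real"
  assumes cvx: "convex_on UNIV g" and "g differentiable (at x)"
  shows "g x - g u \<le> gradient g x \<bullet> (x - u)"
proof -
  define \<phi> where "\<phi> t = g (x + t *\<^sub>R (u - x))" for t :: real
  have "convex_on UNIV \<phi>"
  proof (rule convex_onI)
    fix t a b :: real
    assume "0 < t" "t < 1"
    have "x + ((1 - t) *\<^sub>R a + t *\<^sub>R b) *\<^sub>R (u - x)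
        = (1 - t) *\<^sub>R (x + a *\<^sub>R (u - x)) + t *\<^sub>R (x + b *\<^sub>R (u - x))"
      by (simp add: algebra_simps)
    then show "\<phi> ((1 - t) *\<^sub>R a + t *\<^sub>R b) \<le> (1 - t) * \<phi> a + t * \<phi> b"
      unfolding \<phi>_def using convex_onD[OF cvx, of t] \<open>0 < t\<close> \<open>t < 1\<close> by simp
  qed simp
  moreover have "(\<phi> has_real_derivative (u - x) \<bullet> gradient g x) (at 0)"
  proof -
    have "((\<lambda>t::real. x + t *\<^sub>R (u - x)) has_derivative (\<lambda>t. t *\<^sub>R (u - x))) (at 0)"
      by (auto intro!: derivative_eq_intros)
    moreover have "(g has_derivative (\<lambda>h. h \<bullet> gradient g x)) (at (x + 0 *\<^sub>R (u - x)))"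
      using GDERIV_gradient[OF assms(2)] unfolding gderiv_def by simp
    ultimately have "(\<phi> has_derivative (\<lambda>t. (t *\<^sub>R (u - x)) \<bullet> gradient g x)) (at 0)"
      unfolding \<phi>_def by (rule has_derivative_compose)
    then show ?thesis
      unfolding has_field_derivative_def by (simp add: mult_commute_abs)
  qed
  ultimately have "\<phi> 1 - \<phi> 0 \<ge> ((u - x) \<bullet> gradient g x) * (1 - 0)"
    by (intro convex_on_imp_above_tangent[where A = UNIV]) auto
  then show ?thesis by (simp add: \<phi>_def inner_diff_left inner_diff_right inner_commute)
qed

lemma Lipschitz_family_bounded:
  fixes F :: "'i \<Rightarrow> 'a::real_normed_vector \<Rightarrow> 'b::real_normed_vector"
  assumes "finite I"
    and lip: "\<And>i x y. i \<in> I \<Longrightarrow> norm (F i x - F i y) \<le> L * norm (x - y)"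
  obtains G where "G > 0" and "\<And>i x. i \<in> I \<Longrightarrow> norm x \<le> B \<Longrightarrow> norm (F i x) \<le> G"
proof
  let ?G = "(\<Sum>i\<in>I. norm (F i 0)) + \<bar>L\<bar> * \<bar>B\<bar> + 1"
  show "?G > 0" by (simp add: add_nonneg_pos sum_nonneg)
  fix i and x :: 'a
  assume i: "i \<in> I" and x: "norm x \<le> B"
  have "norm (F i 0) \<le> (\<Sum>i\<in>I. norm (F i 0))"
    using \<open>finite I\<close> i by (intro member_le_sum) auto
  moreover have "L * norm x \<le> \<bar>L\<bar> * \<bar>B\<bar>"
  proof (rule mult_mono)
    show "norm x \<le> \<bar>B\<bar>" using x by linarith
  qed auto
  moreover have "norm (F i x) \<le> norm (F i 0) + norm (F i x - F i 0)"
    using norm_triangle_sub[of "F i x" "F i 0"] by simp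
  moreover have "norm (F i x - F i 0) \<le> L * norm x" using lip[OF i, of x 0] by simp
  ultimately show "norm (F i x) \<le> ?G" by linarith
qed

section \<open>Regret of projected steps along extrapolated gradients\<close>

lemma closed_if_projection_exists:
  fixes X :: "'a::metric_space set"
  assumes "\<And>z. \<exists>p\<in>X. \<forall>y\<in>X. dist z p \<le> dist z y"
  shows "closed X"
proof -
  have "z \<in> X" if z: "z \<in> closure X" for z
  proof -
    obtain p where p: "p \<in> X" "\<And>y. y \<in> X \<Longrightarrow> dist z p \<le> dist z y" using assms by blast
    have "dist z p \<le> e" if "e > 0" for e
    proof -
      obtain y where "y \<in> X" "dist y z < e" using z \<open>e > 0\<close> unfolding closure_approachable by blast
      then show ?thesis using p(2)[of y] by (simp add: dist_commute)
    qed
    then have "dist z p \<le> 0" by (rule dense_ge)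
    then show ?thesis using p(1) by simp
  qed
  then have "closure X \<subseteq> X" by blast
  then show ?thesis by (simp only: closure_subset_eq)
qed

text \<open>
  One round: from the current iterate \<open>x\<close>, the vector \<open>c\<close> leads to the extrapolated point \<open>y\<close>, and
  \<open>a\<close>, in the application the gradient at \<open>y\<close>, leads to the next iterate. The last term vanishes
  if \<open>x\<close> lies in \<open>X\<close>.
\<close>
lemma extrapolated_step:
  fixes X :: "'a::euclidean_space set" and x a c :: 'a and \<gamma> :: real
  assumes X: "convex X" "closed X" and "u \<in> X" and "\<gamma> \<ge> 0" and "norm a \<le> G" and "norm c \<le> G"
  defines "y \<equiv> closest_point X (x - \<gamma> *\<^sub>R c)"
  shows "2 * \<gamma> * (a \<bullet> (y - u)) + (norm (closest_point X (x - \<gamma> *\<^sub>R a) - u))\<^sup>2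
      \<le> (norm (x - u))\<^sup>2 + 3 * (\<gamma>\<^sup>2 * G\<^sup>2) + 2 * \<gamma> * G * norm (x - closest_point X x)"
proof -
  have "X \<noteq> {}" using \<open>u \<in> X\<close> by auto
  have "G \<ge> 0" using \<open>norm a \<le> G\<close> norm_ge_zero[of a] by linarith
  have "dist (closest_point X (x - \<gamma> *\<^sub>R a)) (closest_point X u) \<le> dist (x - \<gamma> *\<^sub>R a) u"
    using X \<open>X \<noteq> {}\<close> by (rule closest_point_lipschitz)
  then have "norm (closest_point X (x - \<gamma> *\<^sub>R a) - u) \<le> norm ((x - u) - \<gamma> *\<^sub>R a)"
    using closest_point_self[OF \<open>u \<in> X\<close>] by (simp add: dist_norm algebra_simps)
  then have "(norm (closest_point X (x - \<gamma> *\<^sub>R a) - u))\<^sup>2 \<le> (norm ((x - u) - \<gamma> *\<^sub>R a))\<^sup>2"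
    by (simp add: power_mono)
  also have "\<dots> = (norm (x - u))\<^sup>2 - 2 * \<gamma> * (a \<bullet> (x - u)) + \<gamma>\<^sup>2 * (norm a)\<^sup>2"
    unfolding power2_norm_eq_inner
    by (simp add: inner_diff_left inner_diff_right inner_commute power2_eq_square algebra_simps)
  finally have step: "(norm (closest_point X (x - \<gamma> *\<^sub>R a) - u))\<^sup>2
      \<le> (norm (x - u))\<^sup>2 - 2 * \<gamma> * (a \<bullet> (x - u)) + \<gamma>\<^sup>2 * G\<^sup>2"
    using mult_left_mono[OF power_mono[OF \<open>norm a \<le> G\<close> norm_ge_zero, of 2], of "\<gamma>\<^sup>2"] by simp
  have "dist (closest_point X (x - \<gamma> *\<^sub>R c)) (closest_point X x) \<le> dist (x - \<gamma> *\<^sub>R c) x"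
    using X \<open>X \<noteq> {}\<close> by (rule closest_point_lipschitz)
  also have "\<dots> \<le> \<gamma> * G"
    using \<open>\<gamma> \<ge> 0\<close> \<open>norm c \<le> G\<close> by (simp add: dist_norm mult_left_mono)
  finally have "norm (y - closest_point X x) \<le> \<gamma> * G"
    by (simp add: y_def dist_norm)
  then have drift: "norm (y - x) \<le> norm (x - closest_point X x) + \<gamma> * G"
    using norm_triangle_ineq[of "y - closest_point X x" "closest_point X x - x"]
    by (simp add: norm_minus_commute)
  have "a \<bullet> (y - x) \<le> norm a * norm (y - x)" by (rule norm_cauchy_schwarz)
  also have "\<dots> \<le> G * (norm (x - closest_point X x) + \<gamma> * G)"
    using \<open>norm a \<le> G\<close> drift \<open>G \<ge> 0\<close> by (intro mult_mono) auto
  finally have "2 * \<gamma> * (a \<bullet> (y - x)) \<le> 2 * \<gamma> * (G * (norm (x - closest_point X x) + \<gamma> * G))"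
    using \<open>\<gamma> \<ge> 0\<close> by (intro mult_left_mono) auto
  moreover have "a \<bullet> (y - u) = a \<bullet> (x - u) + a \<bullet> (y - x)" by (simp add: inner_diff_right)
  ultimately show ?thesis using step by (simp add: algebra_simps power2_eq_square)
qed

lemma extrapolated_gradient_regret:
  fixes X :: "'a::euclidean_space set"
  assumes X: "convex X" "closed X" and "u \<in> X" and bound: "\<And>v. v \<in> X \<Longrightarrow> norm v \<le> B"
    and "\<gamma> > 0" and "x 1 = 0"
    and a: "\<And>t. t \<in> {1..T} \<Longrightarrow> norm (a t) \<le> G" and c: "\<And>t. t \<in> {1..T} \<Longrightarrow> norm (c t) \<le> G"
    and y: "\<And>t. t \<in> {1..T} \<Longrightarrow> y t = closest_point X (x t - \<gamma> *\<^sub>R c t)"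
    and x: "\<And>t. t \<in> {1..T} \<Longrightarrow> x (Suc t) = closest_point X (x t - \<gamma> *\<^sub>R a t)"
    and "G \<ge> 0"
  shows "(\<Sum>t=1..T. a t \<bullet> (y t - u)) \<le> B\<^sup>2 / (2 * \<gamma>) + G * B + 3 / 2 * real T * \<gamma> * G\<^sup>2"
proof -
  have "X \<noteq> {}" using \<open>u \<in> X\<close> by auto
  have "2 * \<gamma> * (\<Sum>t=1..n. a t \<bullet> (y t - u)) + (norm (x (Suc n) - u))\<^sup>2
      \<le> (norm u)\<^sup>2 + 3 * real n * (\<gamma>\<^sup>2 * G\<^sup>2) + 2 * \<gamma> * G * B" if "n \<le> T" for n
    using that
  proof (induction n)
    case 0
    have "B \<ge> 0" using bound[OF \<open>u \<in> X\<close>] norm_ge_zero[of u] by linarith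
    then show ?case using \<open>x 1 = 0\<close> \<open>\<gamma> > 0\<close> \<open>G \<ge> 0\<close> by simp
  next
    case (Suc n)
    then have n: "Suc n \<in> {1..T}" by simp
    have step: "2 * \<gamma> * (a (Suc n) \<bullet> (y (Suc n) - u)) + (norm (x (Suc (Suc n)) - u))\<^sup>2
        \<le> (norm (x (Suc n) - u))\<^sup>2 + 3 * (\<gamma>\<^sup>2 * G\<^sup>2)
          + 2 * \<gamma> * G * norm (x (Suc n) - closest_point X (x (Suc n)))"
      unfolding y[OF n] x[OF n]
      using extrapolated_step[OF X \<open>u \<in> X\<close> _ a[OF n] c[OF n]] \<open>\<gamma> > 0\<close> by simp
    show ?case
    proof (cases "n = 0")
      case True
      \<comment> \<open>only here can the current iterate lie outside \<open>X\<close>\<close>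
      have "norm (x (Suc n) - closest_point X (x (Suc n))) \<le> B"
        using True \<open>x 1 = 0\<close> bound closest_point_in_set[OF X(2) \<open>X \<noteq> {}\<close>] by simp
      then have "2 * \<gamma> * G * norm (x (Suc n) - closest_point X (x (Suc n))) \<le> 2 * \<gamma> * G * B"
        using \<open>\<gamma> > 0\<close> \<open>G \<ge> 0\<close> by (intro mult_left_mono) auto
      then show ?thesis using step True \<open>x 1 = 0\<close> by simp
    next
      case False
      then have "x (Suc n) \<in> X"
        using x[of n] Suc.prems closest_point_in_set[OF X(2) \<open>X \<noteq> {}\<close>] by simp
      then show ?thesis
        using step Suc closest_point_self[of "x (Suc n)" X] by (simp add: algebra_simps)
    qed
  qed
  from this[of T] have "2 * \<gamma> * (\<Sum>t=1..T. a t \<bullet> (y t - u))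
      \<le> (norm u)\<^sup>2 + 3 * real T * (\<gamma>\<^sup>2 * G\<^sup>2) + 2 * \<gamma> * G * B"
    using zero_le_power2[of "norm (x (Suc T) - u)"] by linarith
  also have "\<dots> \<le> B\<^sup>2 + 3 * real T * (\<gamma>\<^sup>2 * G\<^sup>2) + 2 * \<gamma> * G * B"
    using bound[OF \<open>u \<in> X\<close>] by (simp add: power_mono)
  also have "\<dots> = 2 * \<gamma> * (B\<^sup>2 / (2 * \<gamma>) + G * B + 3 / 2 * real T * \<gamma> * G\<^sup>2)"
    using \<open>\<gamma> > 0\<close> by (simp add: field_simps power2_eq_square)
  finally show ?thesis using \<open>\<gamma> > 0\<close> by simp
qed

section \<open>Convergence of the algorithm\<close>

text \<open>
  The guarantee for an arbitrary constant step size. Here \<open>B\<close> bounds the feasible points and \<open>G\<close>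
  the gradients at all points of norm at most \<open>B\<close>.
\<close>
lemma egg_constant_step:
  fixes X :: "'a::euclidean_space set" and f :: "'a \<Rightarrow> 'v set \<Rightarrow> real"
  assumes "finite V" and "1 \<le> k" and X: "convex X" "closed X"
    and bound: "\<And>v. v \<in> X \<Longrightarrow> norm v \<le> B"
    and nonneg: "\<And>x S. S \<subseteq> V \<Longrightarrow> 0 \<le> f x S"
    and cvx: "\<And>S. S \<subseteq> V \<Longrightarrow> convex_on UNIV (\<lambda>x. f x S)"
    and mono: "\<And>x. mono_on (Pow V) (f x)" and sub: "\<And>x. submodular_on V (f x)"
    and diff: "\<And>x S. S \<subseteq> V \<Longrightarrow> card S \<le> k \<Longrightarrow> (\<lambda>y. f y S) differentiable (at x)"
    and G: "\<And>x S. S \<subseteq> V \<Longrightarrow> card S \<le> k \<Longrightarrow> norm x \<le> B \<Longrightarrow> norm (gradient (\<lambda>y. f y S) x) \<le> G"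
    and "u \<in> X" and "\<gamma> > 0" and "T \<ge> 1" and run: "egg_run V f k X (\<lambda>_. \<gamma>) T x xh S Sh"
  shows "(1 - 1 / exp 1) * max_value V f k (egg_solution (\<lambda>_. \<gamma>) T xh)
      \<le> max_value V f k u + (B\<^sup>2 / (2 * \<gamma>) + G * B) / real T + 3 / 2 * \<gamma> * G\<^sup>2"
proof -
  let ?\<alpha> = "1 - 1 / exp 1 :: real"
  let ?M = "max_value V f k"
  have "X \<noteq> {}" using \<open>u \<in> X\<close> by auto
  note proj = closest_point_in_set[OF X(2) \<open>X \<noteq> {}\<close>]
  have "B \<ge> 0" using bound[OF \<open>u \<in> X\<close>] norm_ge_zero[of u] by linarith
  then have "G \<ge> 0" using order_trans[OF norm_ge_zero G[of "{}" 0]] by simp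
  have x1: "x 1 = 0" "S 1 = {}" using run by (auto simp: egg_run_def)
  have xh: "xh t = closest_point X (x t - \<gamma> *\<^sub>R gradient (\<lambda>y. f y (S t)) (x t))"
    and Sh: "greedy_output V f k (xh t) (Sh t)"
    and x': "x (Suc t) = closest_point X (x t - \<gamma> *\<^sub>R gradient (\<lambda>y. f y (Sh t)) (xh t))"
    and S': "greedy_output V f k (x (Suc t)) (S (Suc t))" if "t \<in> {1..T}" for t
    using run that unfolding egg_run_def Suc_eq_plus1 by blast+
  have cur: "norm (x t) \<le> B \<and> S t \<subseteq> V \<and> card (S t) \<le> k" if t: "t \<in> {1..T}" for t
  proof (cases "t = 1")
    case True
    then show ?thesis using x1 \<open>B \<ge> 0\<close> by simp
  next
    case False
    then obtain s where s: "t = Suc s" "s \<in> {1..T}" using t by (cases t) auto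
    then show ?thesis
      using x'[OF s(2)] bound proj greedy_output_feasible[OF \<open>finite V\<close> S'[OF s(2)]] by simp
  qed
  have hat: "norm (xh t) \<le> B" "Sh t \<subseteq> V" "card (Sh t) \<le> k" if "t \<in> {1..T}" for t
    using xh[OF that] bound proj greedy_output_feasible[OF \<open>finite V\<close> Sh[OF that]] by auto
  have round: "?\<alpha> * ?M (xh t) \<le> ?M u + gradient (\<lambda>y. f y (Sh t)) (xh t) \<bullet> (xh t - u)"
    if t: "t \<in> {1..T}" for t
  proof -
    obtain Q where Q: "Q \<subseteq> V" "card Q \<le> k" "?M (xh t) = f (xh t) Q"
      using max_value_attained[OF \<open>finite V\<close>] by metis
    have "?\<alpha> * f (xh t) Q \<le> f (xh t) (Sh t)"
      using greedy_approximation[OF \<open>finite V\<close> \<open>1 \<le> k\<close> sub mono nonneg Sh[OF t] Q(1,2)] by simp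
    moreover have "f (xh t) (Sh t) - f u (Sh t) \<le> gradient (\<lambda>y. f y (Sh t)) (xh t) \<bullet> (xh t - u)"
      using convex_on_gradient_lower_bound[OF cvx diff] hat[OF t] by blast
    moreover have "f u (Sh t) \<le> ?M u"
      using \<open>finite V\<close> hat(2,3)[OF t] by (rule max_value_upper)
    ultimately show ?thesis unfolding Q(3) by linarith
  qed
  have "egg_solution (\<lambda>_. \<gamma>) T xh = (\<Sum>t=1..T. (1 / real T) *\<^sub>R xh t)"
    unfolding egg_solution_def scaleR_right.sum using \<open>\<gamma> > 0\<close> by (intro sum.cong) (auto simp: field_simps)
  also have "?M \<dots> \<le> (\<Sum>t=1..T. (1 / real T) * ?M (xh t))"
    using \<open>T \<ge> 1\<close> by (intro convex_on_sum[OF _ _ convex_on_max_value[OF \<open>finite V\<close> cvx]]) auto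
  finally have "?\<alpha> * ?M (egg_solution (\<lambda>_. \<gamma>) T xh) \<le> ?\<alpha> * (\<Sum>t=1..T. (1 / real T) * ?M (xh t))"
    by (intro mult_left_mono) auto
  also have "\<dots> = (\<Sum>t=1..T. ?\<alpha> * ?M (xh t)) / real T"
    by (simp add: sum_distrib_left sum_divide_distrib)
  also have "\<dots> \<le> (\<Sum>t=1..T. ?M u + gradient (\<lambda>y. f y (Sh t)) (xh t) \<bullet> (xh t - u)) / real T"
    using round by (intro divide_right_mono sum_mono) auto
  also have "\<dots> = ?M u + (\<Sum>t=1..T. gradient (\<lambda>y. f y (Sh t)) (xh t) \<bullet> (xh t - u)) / real T"
    using \<open>T \<ge> 1\<close> by (simp add: sum.distrib add_divide_distrib)
  also have "\<dots> \<le> ?M u + (B\<^sup>2 / (2 * \<gamma>) + G * B + 3 / 2 * real T * \<gamma> * G\<^sup>2) / real T"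
    using extrapolated_gradient_regret[where x = x and y = xh and T = T and \<gamma> = \<gamma> and G = G
        and a = "\<lambda>t. gradient (\<lambda>y. f y (Sh t)) (xh t)"
        and c = "\<lambda>t. gradient (\<lambda>y. f y (S t)) (x t)",
        OF X \<open>u \<in> X\<close> bound \<open>\<gamma> > 0\<close> x1(1) _ _ xh x' \<open>G \<ge> 0\<close>] G cur hat
    by (intro add_left_mono divide_right_mono) auto
  also have "\<dots> = ?M u + (B\<^sup>2 / (2 * \<gamma>) + G * B) / real T + 3 / 2 * \<gamma> * G\<^sup>2"
    using \<open>T \<ge> 1\<close> by (simp add: add_divide_distrib)
  finally show ?thesis .
qed

text \<open>
  With these parameters the summands \<open>B\<^sup>2 / (2 \<gamma> T)\<close>, \<open>G B / T\<close> and \<open>3 \<gamma> G\<^sup>2 / 2\<close> are at most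
  \<open>\<epsilon>/4\<close>, \<open>\<epsilon>/2\<close> and \<open>\<epsilon>/4\<close>.
\<close>
lemma egg_parameters:
  fixes B G \<epsilon> M \<gamma> :: real and T :: nat
  assumes "B \<ge> 0" and "G > 0" and "0 < \<epsilon>" and "\<epsilon> < 1"
  defines "M \<equiv> 12 * B\<^sup>2 * G\<^sup>2 + 2 * G * B + 1" and "\<gamma> \<equiv> 1 / (6 * G\<^sup>2) * \<epsilon>"
    and "T \<equiv> nat \<lceil>M / \<epsilon>\<^sup>2\<rceil>"
  shows "1 \<le> T" and "real T \<le> (M + 1) * (1 / \<epsilon>\<^sup>2)" and "\<gamma> > 0"
    and "(B\<^sup>2 / (2 * \<gamma>) + G * B) / real T + 3 / 2 * \<gamma> * G\<^sup>2 \<le> \<epsilon>"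
proof -
  have "M \<ge> 1" using assms(1,2) by (simp add: M_def)
  have "\<epsilon>\<^sup>2 > 0" "\<epsilon>\<^sup>2 \<le> 1"
    using assms(3,4) by (auto intro: power_le_one)
  have T: "M / \<epsilon>\<^sup>2 \<le> real T" "real T \<le> M / \<epsilon>\<^sup>2 + 1"
    using \<open>M \<ge> 1\<close> \<open>\<epsilon>\<^sup>2 > 0\<close> unfolding T_def
    by (auto simp: real_nat_ceiling_ge of_nat_ceiling)
  have "M / \<epsilon>\<^sup>2 > 0" using \<open>M \<ge> 1\<close> \<open>\<epsilon>\<^sup>2 > 0\<close> by simp
  then show "1 \<le> T" using T(1) by (cases "T = 0") auto
  show "real T \<le> (M + 1) * (1 / \<epsilon>\<^sup>2)"
    using T(2) \<open>\<epsilon>\<^sup>2 > 0\<close> \<open>\<epsilon>\<^sup>2 \<le> 1\<close> by (simp add: field_simps)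
  show "\<gamma> > 0" using assms by (simp add: \<gamma>_def)
  have "B\<^sup>2 / (2 * \<gamma>) + G * B = (3 * B\<^sup>2 * G\<^sup>2 + \<epsilon> * (G * B)) / \<epsilon>"
    using assms by (simp add: \<gamma>_def field_simps)
  also have "\<dots> \<le> (3 * B\<^sup>2 * G\<^sup>2 + G * B) / \<epsilon>"
    using assms by (intro divide_right_mono add_left_mono mult_left_le_one_le) auto
  also have "\<dots> \<le> (3 / 4 * M) / \<epsilon>"
    using assms by (intro divide_right_mono) (auto simp: M_def)
  also have "\<dots> = 3 / 4 * \<epsilon> * (M / \<epsilon>\<^sup>2)"
    using assms(3) by (simp add: field_simps power2_eq_square)
  also have "\<dots> \<le> 3 / 4 * \<epsilon> * real T"
    using T(1) assms(3) by (intro mult_left_mono) auto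
  finally have "(B\<^sup>2 / (2 * \<gamma>) + G * B) / real T \<le> 3 / 4 * \<epsilon>"
    using \<open>1 \<le> T\<close> by (simp add: pos_divide_le_eq)
  moreover have "3 / 2 * \<gamma> * G\<^sup>2 = \<epsilon> / 4" using assms(2) by (simp add: \<gamma>_def)
  ultimately show "(B\<^sup>2 / (2 * \<gamma>) + G * B) / real T + 3 / 2 * \<gamma> * G\<^sup>2 \<le> \<epsilon>" by linarith
qed

theorem theorem4:
  fixes V :: "'v set"
    and k :: nat
    and X :: "(real ^ 'd) set"
    and f :: "real ^ 'd \<Rightarrow> 'v set \<Rightarrow> real"
    and L :: real
  assumes finite_V: "finite V"
    and k_pos: "1 \<le> k" and k_le: "k \<le> card V"
    and convex_X: "convex X" and bounded_X: "bounded X"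
    and projection_well_defined:
      "\<And>z. \<exists>!p. p \<in> X \<and> (\<forall>y\<in>X. dist z p \<le> dist z y)"
    and f_nonneg: "\<And>x S. S \<subseteq> V \<Longrightarrow> 0 \<le> f x S"
    and f_convex: "\<And>S. S \<subseteq> V \<Longrightarrow> convex_on UNIV (\<lambda>x. f x S)"
    and f_monotone: "\<And>x. mono_on (Pow V) (f x)"
    and f_submodular: "\<And>x. submodular_on V (f x)"
    and f_differentiable:
      "\<And>x S. S \<subseteq> V \<Longrightarrow> card S \<le> k \<Longrightarrow> (\<lambda>y. f y S) differentiable (at x)"
    and gradient_lipschitz:
      "\<And>x x' S. S \<subseteq> V \<Longrightarrow> card S \<le> k \<Longrightarrow>
         norm (gradient (\<lambda>y. f y S) x - gradient (\<lambda>y. f y S) x') \<le> L * norm (x - x')"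
  shows "\<exists>C\<^sub>T>0. \<exists>C\<^sub>\<gamma>>0. \<exists>\<epsilon>\<^sub>0>0. \<forall>\<epsilon>. 0 < \<epsilon> \<and> \<epsilon> < \<epsilon>\<^sub>0 \<longrightarrow>
    (\<exists>(T::nat) (\<gamma>::nat \<Rightarrow> real).
       1 \<le> T \<and> real T \<le> C\<^sub>T * (1 / \<epsilon>\<^sup>2) \<and>
       (\<forall>t\<in>{1..T}. 0 < \<gamma> t \<and> \<gamma> t \<le> C\<^sub>\<gamma> * \<epsilon>) \<and>
       (\<forall>x xh S Sh. egg_run V f k X \<gamma> T x xh S Sh \<longrightarrow>
          approx_minimax_solution V f k X (1 - 1 / exp 1) \<epsilon> (egg_solution \<gamma> T xh)))"
proof -
  have "X \<noteq> {}" using projection_well_defined by blast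
  have "closed X" using projection_well_defined by (intro closed_if_projection_exists) blast
  obtain B where "B > 0" and B: "\<And>v. v \<in> X \<Longrightarrow> norm v \<le> B"
    using bounded_X unfolding bounded_pos by blast
  have "finite {S. S \<subseteq> V \<and> card S \<le> k}" using finite_V by simp
  then obtain G where "G > 0"
    and G: "\<And>S x. S \<in> {S. S \<subseteq> V \<and> card S \<le> k} \<Longrightarrow> norm x \<le> B \<Longrightarrow> norm (gradient (\<lambda>y. f y S) x) \<le> G"
  proof (rule Lipschitz_family_bounded[where F = "\<lambda>S. gradient (\<lambda>y. f y S)" and B = B])
    show "norm (gradient (\<lambda>y. f y S) x - gradient (\<lambda>y. f y S) x') \<le> L * norm (x - x')"
      if "S \<in> {S. S \<subseteq> V \<and> card S \<le> k}" for S x x'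
      using that gradient_lipschitz by simp
  qed blast
  let ?M = "12 * B\<^sup>2 * G\<^sup>2 + 2 * G * B + 1"
  have main: "\<exists>(T::nat) (\<gamma>::nat \<Rightarrow> real).
       1 \<le> T \<and> real T \<le> (?M + 1) * (1 / \<epsilon>\<^sup>2) \<and>
       (\<forall>t\<in>{1..T}. 0 < \<gamma> t \<and> \<gamma> t \<le> 1 / (6 * G\<^sup>2) * \<epsilon>) \<and>
       (\<forall>x xh S Sh. egg_run V f k X \<gamma> T x xh S Sh \<longrightarrow>
          approx_minimax_solution V f k X (1 - 1 / exp 1) \<epsilon> (egg_solution \<gamma> T xh))"
    if "0 < \<epsilon>" "\<epsilon> < 1" for \<epsilon>
  proof -
    define T where "T = nat \<lceil>?M / \<epsilon>\<^sup>2\<rceil>"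
    define \<gamma> where "\<gamma> = 1 / (6 * G\<^sup>2) * \<epsilon>"
    note params = egg_parameters[OF less_imp_le[OF \<open>B > 0\<close>] \<open>G > 0\<close> that, folded T_def \<gamma>_def]
    have "approx_minimax_solution V f k X (1 - 1 / exp 1) \<epsilon> (egg_solution (\<lambda>_. \<gamma>) T xh)"
      if run: "egg_run V f k X (\<lambda>_. \<gamma>) T x xh S Sh" for x xh S Sh
    proof -
      let ?v = "(1 - 1 / exp 1) * max_value V f k (egg_solution (\<lambda>_. \<gamma>) T xh)"
      have "?v - \<epsilon> \<le> max_value V f k u" if "u \<in> X" for u
      proof -
        have "?v \<le> max_value V f k u + (B\<^sup>2 / (2 * \<gamma>) + G * B) / real T + 3 / 2 * \<gamma> * G\<^sup>2"
          using G by (intro egg_constant_step[OF finite_V k_pos convex_X \<open>closed X\<close> B f_nonneg f_convex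
            f_monotone f_submodular f_differentiable _ that params(3,1) run]) simp_all
        then show ?thesis using params(4) by linarith
      qed
      then have "?v - \<epsilon> \<le> (INF u\<in>X. max_value V f k u)"
        using \<open>X \<noteq> {}\<close> by (intro cINF_greatest) auto
      then show ?thesis unfolding approx_minimax_solution_def minimax_value_def by simp
    qed
    then show ?thesis
      using params(1-3) unfolding \<gamma>_def by (intro exI[of _ T] exI[of _ "\<lambda>_. 1 / (6 * G\<^sup>2) * \<epsilon>"]) auto
  qed
  have "?M + 1 > 0" "1 / (6 * G\<^sup>2) > 0"
    using \<open>B > 0\<close> \<open>G > 0\<close> by (auto intro!: add_nonneg_pos)
  then show ?thesis
    using main by (intro exI[of _ "?M + 1"] exI[of _ "1 / (6 * G\<^sup>2)"] exI[of _ "1::real"] conjI allI impI)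
      (simp_all only: zero_less_one)
qed

end
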